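(* Let $\mathscr{F}$ be an $\omega$-closed family of nonempty inductive subsets of $\omega$ which contains at least two sets. Then for every injective endomorphism $\varepsilon$ of the monoid $\boldsymbol{B}_{\omega}^{\mathscr{F}}$ the following conditions are equivalent: (i) $\varepsilon$ is the identity map; (ii) there exists a non-idempotent element $(i,j,[p))\in\boldsymbol{B}_{\omega}^{\mathscr{F}}$ such that $(i,j,[p))\varepsilon=(i,j,[p))$; (iii) $\varepsilon$ has at least three (distinct) fixed points.
   Context: $\omega$ denotes the set of non-negative integers, and $[k)=\{i\in\omega: i\geqslant k\}$ for $k\in\omega$. For an integer $n$ and a nonempty $F\subseteq\omega$, $n+F=\{n+k: k\in F\}$ (a set of integers), and $n+\varnothing=\varnothing$. A nonempty family $\mathscr{F}$ of subsets of $\omega$ is $\omega$-closed if $F_1\cap(-n+F_2)\in\mathscr{F}$ for all $n\in\omega$ and $F_1,F_2\in\mathscr{F}$. A subset $A\subseteq\omega$ is inductive if $i\in A$ implies $i+1\in A$; the nonempty inductive subsets of $\omega$ are exactly the sets $[k)$, $k\in\omega$. For an $\omega$-closed family $\mathscr{F}$ of nonempty inductive subsets of $\omega$, $\boldsymbol{B}_{\omega}^{\mathscr{F}}$ is the set $\omega\times\omega\times\mathscr{F}$ with the associative operation $$(i_1,j_1,F_1)\cdot(i_2,j_2,F_2)=\begin{cases}(i_1-j_1+i_2,\ j_2,\ (j_1-i_2+F_1)\cap F_2), & j_1<i_2;\\ (i_1,\ j_2,\ F_1\cap F_2), & j_1=i_2;\\ (i_1,\ j_1-i_2+j_2,\ F_1\cap(i_2-j_1+F_2)),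 & j_1>i_2.\end{cases}$$ It is a monoid, with identity $(0,0,[m))$, where $[m)$ is the largest member of $\mathscr{F}$ with respect to inclusion. An endomorphism of the monoid is a homomorphism from it to itself preserving the identity. Maps are written on the right: $x\varepsilon$ is the image of $x$ under $\varepsilon$. A fixed point of $\varepsilon$ is an element $x$ with $x\varepsilon=x$. *)

theory Defs
  imports "HOL-Algebra.Group"
begin

definition shift :: "int \<Rightarrow> nat set \<Rightarrow> int set" where
  "shift n F = {n + int k | k. k \<in> F}"

text \<open>The intersection \<open>A \<inter> (n + B)\<close>, for \<open>A\<close> and \<open>B\<close> sets of naturals. As \<open>A\<close> contains only
  non-negative integers, the result is again a set of naturals, although \<open>n + B\<close> need not be.\<close>

definition inter_shift :: "nat set \<Rightarrow> int \<Rightarrow> nat set \<Rightarrow> nat set" where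
  "inter_shift A n B = {k \<in> A. int k \<in> shift n B}"

definition omega_closed :: "nat set set \<Rightarrow> bool" where
  "omega_closed \<F> \<longleftrightarrow> \<F> \<noteq> {} \<and>
     (\<forall>n::nat. \<forall>F\<^sub>1\<in>\<F>. \<forall>F\<^sub>2\<in>\<F>. inter_shift F\<^sub>1 (- int n) F\<^sub>2 \<in> \<F>)"

definition inductive_subset :: "nat set \<Rightarrow> bool" where
  "inductive_subset A \<longleftrightarrow> (\<forall>i\<in>A. i + 1 \<in> A)"

text \<open>All subtractions on \<open>nat\<close> below are exact: in each branch the subtrahend is at most the
  minuend.\<close>

fun B_mult :: "nat \<times> nat \<times> nat set \<Rightarrow> nat \<times> nat \<times> nat set \<Rightarrow> nat \<times> nat \<times> nat set" where
  "B_mult (i\<^sub>1, j\<^sub>1, F\<^sub>1) (i\<^sub>2, j\<^sub>2, F\<^sub>2) =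
     (if j\<^sub>1 < i\<^sub>2 then (i\<^sub>1 + i\<^sub>2 - j\<^sub>1, j\<^sub>2, inter_shift F\<^sub>2 (int j\<^sub>1 - int i\<^sub>2) F\<^sub>1)
      else if j\<^sub>1 = i\<^sub>2 then (i\<^sub>1, j\<^sub>2, F\<^sub>1 \<inter> F\<^sub>2)
      else (i\<^sub>1, j\<^sub>1 - i\<^sub>2 + j\<^sub>2, inter_shift F\<^sub>1 (int i\<^sub>2 - int j\<^sub>1) F\<^sub>2))"

definition B_omega :: "nat set set \<Rightarrow> (nat \<times> nat \<times> nat set) monoid" where
  "B_omega \<F> = \<lparr>carrier = UNIV \<times> UNIV \<times> \<F>, mult = B_mult,
     one = (0, 0, GREATEST F. F \<in> \<F>)\<rparr>"

text \<open>Maps between carriers are total functions on the underlying type; only their values on the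
  carrier are meaningful.\<close>

definition monoid_endomorphism :: "('a, 'b) monoid_scheme \<Rightarrow> ('a \<Rightarrow> 'a) \<Rightarrow> bool" where
  "monoid_endomorphism M \<epsilon> \<longleftrightarrow> \<epsilon> \<in> hom M M \<and> \<epsilon> \<one>\<^bsub>M\<^esub> = \<one>\<^bsub>M\<^esub>"

definition fixed_points :: "('a, 'b) monoid_scheme \<Rightarrow> ('a \<Rightarrow> 'a) \<Rightarrow> 'a set" where
  "fixed_points M \<epsilon> = {x \<in> carrier M. \<epsilon> x = x}"

end

theory Submission
  imports Defs
begin

text \<open>Translating the sets \<open>[p)\<close>, assume the largest member of the family is \<open>[0)\<close>. Then
  \<open>(i, j, [p)) \<mapsto> ((i, j), (i + p, j + p))\<close> embeds the monoid into the square of the bicyclic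
  monoid, and idempotents become pairs \<open>(i; i + p)\<close> multiplied by componentwise maximum.
  Since \<open>(0, 1, [0))\<close> and \<open>(1, 0, [0))\<close> have product \<open>1\<close>, an injective endomorphism multiplies
  the first two coordinates of each \<open>(i, j, [0))\<close> by some \<open>k > 0\<close>, and hence \<open>i - j\<close> by \<open>k\<close> on
  the whole monoid. If \<open>k = 1\<close>, then \<open>(0; p + 1)\<close> is sent strictly between \<open>(0; p)\<close> and
  \<open>(1; p + 1)\<close> and so, by injectivity and induction on \<open>p\<close>, is fixed. If \<open>k > 1\<close>, only
  idempotents \<open>(0; p)\<close> can be fixed, and conjugating \<open>(0; q)\<close> to \<open>(0; p)\<close> by a shift of
  \<open>q - p\<close>, for \<open>0 < p < q\<close>, shows that no two of them with \<open>p, q > 0\<close> are.\<close>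

text \<open>The bicyclic pairs \<open>(i, j)\<close> and \<open>(i + p, j + p)\<close> are
  multiplied side by side; the last entry is the difference of the two maxima that occur.\<close>

fun ext_mult :: "nat \<times> nat \<times> nat \<Rightarrow> nat \<times> nat \<times> nat \<Rightarrow> nat \<times> nat \<times> nat" where
  "ext_mult (i\<^sub>1, j\<^sub>1, p\<^sub>1) (i\<^sub>2, j\<^sub>2, p\<^sub>2) =
     (i\<^sub>1 + max j\<^sub>1 i\<^sub>2 - j\<^sub>1, j\<^sub>2 + max j\<^sub>1 i\<^sub>2 - i\<^sub>2, max (j\<^sub>1 + p\<^sub>1) (i\<^sub>2 + p\<^sub>2) - max j\<^sub>1 i\<^sub>2)"

lemma ext_mult_idem_iff: "ext_mult (i, j, p) (i, j, p) = (i, j, p) \<longleftrightarrow> i = j"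
  by (auto simp: max_def)

text \<open>The outer entries \<open>i\<close> and \<open>j'\<close> only grow in a product, so both
  are 0. No growth means that the inner entries \<open>j\<close> and \<open>i'\<close> agree, and
  then the last entry is the maximum of \<open>p\<close> and \<open>p'\<close>.\<close>

lemma ext_mult_eq_one:
  assumes "ext_mult x y = (0, 0, 0)"
  shows "\<exists>k. x = (0, k, 0) \<and> y = (k, 0, 0)"
proof -
  obtain i j p i' j' p' where "x = (i, j, p)" "y = (i', j', p')"
    by (metis prod.exhaust)
  with assms show ?thesis
    by (auto simp: max_def split: if_splits)
qed

text \<open>\<open>P\<close> holds the offsets of the members of the family from the largest one.
  Closure concerns the third entry alone, as the other two range over all naturals.\<close>

locale ext_bicyclic_endomorphism =
  fixes P :: "nat set" and \<phi> :: "nat \<times> nat \<times> nat \<Rightarrow> nat \<times> nat \<times> nat"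
  assumes zero_mem: "0 \<in> P"
    and down_closed: "q \<in> P \<Longrightarrow> p \<le> q \<Longrightarrow> p \<in> P"
    and closed: "p \<in> P \<Longrightarrow> snd (snd (\<phi> (i, j, p))) \<in> P"
    and hom_mult: "p \<in> P \<Longrightarrow> q \<in> P \<Longrightarrow>
          \<phi> (ext_mult (i, j, p) (i', j', q)) = ext_mult (\<phi> (i, j, p)) (\<phi> (i', j', q))"
    and hom_one: "\<phi> (0, 0, 0) = (0, 0, 0)"
    and inj: "inj_on \<phi> (UNIV \<times> UNIV \<times> P)"
begin

section \<open>The scaling factor and the shape of the endomorphism\<close>

lemma scale_exists: "\<exists>k. \<phi> (0, 1, 0) = (0, k, 0) \<and> \<phi> (1, 0, 0) = (k, 0, 0)"
  using hom_mult[of 0 0 0 1 1 0] zero_mem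
  by (intro ext_mult_eq_one) (simp add: hom_one)

definition scale :: nat where
  "scale = (SOME k. \<phi> (0, 1, 0) = (0, k, 0) \<and> \<phi> (1, 0, 0) = (k, 0, 0))"

lemma scale: "\<phi> (0, 1, 0) = (0, scale, 0)" "\<phi> (1, 0, 0) = (scale, 0, 0)"
  using someI_ex[OF scale_exists] unfolding scale_def by blast+

lemma scale_pos: "scale > 0"
proof (rule ccontr)
  assume "\<not> scale > 0"
  then have "\<phi> (0, 1, 0) = \<phi> (0, 0, 0)"
    using scale hom_one by simp
  then show False
    using inj zero_mem by (auto dest: inj_onD)
qed

lemma apply_left: "\<phi> (i, 0, 0) = (scale * i, 0, 0)"
proof (induction i)
  case 0
  then show ?case by (simp add: hom_one)
next
  case (Suc i)
  then show ?case
    using hom_mult[of 0 0 1 0 i 0] zero_mem scale by (simp add: max_def)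
qed

lemma apply_right: "\<phi> (0, j, 0) = (0, scale * j, 0)"
proof (induction j)
  case 0
  then show ?case by (simp add: hom_one)
next
  case (Suc j)
  then show ?case
    using hom_mult[of 0 0 0 1 0 j] hom_mult[of 0 0 0 j 0 1] zero_mem scale by (simp add: max_def)
qed

lemma apply_diag:
  assumes "p \<in> P"
  obtains s r where "\<phi> (0, 0, p) = (s, s, r)" "r \<in> P"
proof -
  obtain s s' r where *: "\<phi> (0, 0, p) = (s, s', r)"
    by (metis prod.exhaust)
  then have "ext_mult (s, s', r) (s, s', r) = (s, s', r)"
    using hom_mult[of p p 0 0 0 0] assms by simp
  then have "s = s'"
    unfolding ext_mult_idem_iff .
  then show thesis
    using that * closed[OF assms, of 0 0] by simp
qed

text \<open>The factorization \<open>(i, 0, 0) (0, 0, p) (0, j, 0)\<close> of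
  \<open>(i, j, p)\<close> leaves only \<open>scale\<close> and the images of the
  \<open>(0, 0, p)\<close> to be determined.\<close>

lemma apply_eq:
  assumes "p \<in> P" "\<phi> (0, 0, p) = (s, s, r)"
  shows "\<phi> (i, j, p) = (scale * i + s, scale * j + s, r)"
proof -
  have "\<phi> (i, 0, p) = (scale * i + s, s, r)"
    using hom_mult[of 0 p i 0 0 0] assms zero_mem by (simp add: apply_left max_def)
  then show ?thesis
    using hom_mult[of p 0 i 0 0 j] assms zero_mem by (simp add: apply_right max_def)
qed

lemma identity_if_scale_one:
  assumes "scale = 1" "p \<in> P"
  shows "\<phi> (i, j, p) = (i, j, p)"
proof -
  have "\<phi> (0, 0, p) = (0, 0, p)"
    using \<open>p \<in> P\<close>
  proof (induction p rule: less_induct)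
    case (less q)
    show ?case
    proof (cases q)
      case 0
      then show ?thesis by (simp add: hom_one)
    next
      case (Suc p)
      have pP: "p \<in> P"
        using less.prems Suc down_closed by simp
      obtain s r where sr: "\<phi> (0, 0, q) = (s, s, r)" "r \<in> P"
        using apply_diag less.prems by blast
      have fix_lower: "\<phi> (i, i, r') = (i, i, r')" if "r' < q" for i r'
        using apply_eq[of r' 0 r' i i] less.IH[OF that] less.prems down_closed that assms(1)
        by (simp add: less_imp_le)
      \<comment> \<open>Idempotents multiply as maxima, so absorption is an order. Here
        \<open>(0, 0, p)\<close> and \<open>(1, 1, p)\<close> are fixed and \<open>(0, 0, q)\<close>
        lies between them; hence so does its image.\<close>
      have lower: "p \<le> s + r"
        using hom_mult[of p q 0 0 0 0] pP less.prems Suc sr fix_lower[of p]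
        by (auto simp: max_def split: if_splits)
      have upper: "s \<le> 1" "s + r \<le> q"
        using hom_mult[of q p 0 0 1 1] pP less.prems Suc sr fix_lower[of p]
        by (auto simp: max_def split: if_splits)
      \<comment> \<open>Otherwise \<open>(s, s, r)\<close> would itself be fixed and so share its
        image with \<open>(0, 0, q)\<close>. Together with \<open>s + r \<le> q\<close> this leaves
        only \<open>s = 0\<close> and \<open>r = q\<close>.\<close>
      have "\<not> r < q"
      proof
        assume "r < q"
        then have "\<phi> (s, s, r) = \<phi> (0, 0, q)"
          using fix_lower sr by simp
        then have "r = q"
          using inj sr(2) less.prems by (auto dest: inj_onD)
        with \<open>r < q\<close> show False by simp
      qed
      then show ?thesis
        using upper sr by simp
    qed
  qed
  then show ?thesis
    using apply_eq[of p 0 p i j] assms by simp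
qed

section \<open>Fixed points that force the factor to be one\<close>

lemma scale_one_if_nonidempotent_fixed:
  assumes "p \<in> P" "i \<noteq> j" "\<phi> (i, j, p) = (i, j, p)"
  shows "scale = 1"
proof -
  obtain s r where "\<phi> (0, 0, p) = (s, s, r)"
    using apply_diag assms by blast
  then have "scale * i + s = i" "scale * j + s = j"
    using apply_eq[of p s r i j] assms by auto
  \<comment> \<open>Subtracting the two equations eliminates the unknown \<open>s\<close>; integers
    allow either sign of \<open>i - j\<close>.\<close>
  then have "int scale * (int i - int j) = int i - int j"
    by (metis add_diff_cancel_right int_ops(7) of_nat_add right_diff_distrib)
  then show ?thesis
    using assms(2) by simp
qed

lemma scale_one_if_two_fixed:
  assumes "q \<in> P" "0 < p" "p < q" "\<phi> (0, 0, p) = (0, 0, p)" "\<phi> (0, 0, q) = (0, 0, q)"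
  shows "scale = 1"
proof -
  define d where "d = q - p"
  have q: "q = p + d" "d > 0"
    using assms d_def by auto
  \<comment> \<open>The left shift by \<open>d\<close> turns \<open>(0, 0, q)\<close> into
    \<open>(0, d, p)\<close>, whose image is thus computed in two ways.\<close>
  have "\<phi> (0, d, p) = ext_mult (0, scale * d, 0) (0, 0, q)"
    using hom_mult[of 0 q 0 d 0 0] assms zero_mem q by (simp add: apply_right max_def)
  moreover have "\<phi> (0, d, p) = (0, scale * d, p)"
    using apply_eq[of p 0 p 0 d] assms down_closed by simp
  ultimately have "max (scale * d) (p + d) = p + scale * d"
    using q by auto
  \<comment> \<open>As \<open>0 < p\<close>, the maximum cannot be \<open>scale * d\<close>, so it
    is \<open>p + d\<close>.\<close>
  then have "scale * d = d"
    using assms(2) by linarith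
  then show ?thesis
    using q by simp
qed

text \<open>The factor is then at least 2, and \<open>scale * i + s = i\<close> gives
  \<open>2 * i \<le> i\<close>.\<close>

lemma fixed_if_scale_not_one:
  assumes "scale \<noteq> 1" "p \<in> P" "\<phi> (i, j, p) = (i, j, p)"
  shows "i = 0 \<and> j = 0"
proof -
  obtain s r where "\<phi> (0, 0, p) = (s, s, r)"
    using apply_diag assms by blast
  then have "scale * i + s = i" "scale * j + s = j"
    using apply_eq[of p s r i j] assms by auto
  moreover have "2 * n \<le> scale * n" for n
    using assms(1) scale_pos by (intro mult_le_mono1) simp
  ultimately show ?thesis
    by (metis add_leD1 add_cancel_right_right mult_2 le_antisym le_add1)
qed

lemma scale_one_if_three_fixed:
  assumes "x \<in> UNIV \<times> UNIV \<times> P" "y \<in> UNIV \<times> UNIV \<times> P" "z \<in> UNIV \<times> UNIV \<times> P"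
    and "\<phi> x = x" "\<phi> y = y" "\<phi> z = z" and "x \<noteq> y" "y \<noteq> z" "x \<noteq> z"
  shows "scale = 1"
proof (rule ccontr)
  assume scale: "scale \<noteq> 1"
  have "\<exists>p\<in>P. v = (0, 0, p)" if "v \<in> UNIV \<times> UNIV \<times> P" "\<phi> v = v" for v
    using that fixed_if_scale_not_one[OF scale] by auto
  then obtain p q r where pqr: "x = (0, 0, p)" "y = (0, 0, q)" "z = (0, 0, r)"
      "p \<in> P" "q \<in> P" "r \<in> P"
    using assms by meson
  have "u = v" if "u \<in> P" "v \<in> P" "0 < u" "0 < v"
    "\<phi> (0, 0, u) = (0, 0, u)" "\<phi> (0, 0, v) = (0, 0, v)" for u v
    using scale_one_if_two_fixed[of u v] scale_one_if_two_fixed[of v u] that scale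
    by (metis linorder_neqE_nat)
  \<comment> \<open>At most one of the three distinct offsets is 0, so two distinct positive ones
    remain.\<close>
  then show False
    using assms pqr by (metis gr0I)
qed

end

section \<open>Intervals in the family and the change of coordinates\<close>

lemma inter_shift_atLeast:
  assumes "j \<le> i"
  shows "inter_shift {a..} (int j - int i) {b..} = {max a (b + j - i)..}"
proof -
  have "(\<exists>l. int k = int j - int i + int l \<and> b \<le> l) \<longleftrightarrow> b + j - i \<le> k" for k
    using assms by (auto intro!: exI[of _ "k + i - j"])
  then show ?thesis
    by (auto simp: inter_shift_def shift_def)
qed

lemma inductive_subset_eq_atLeast:
  assumes "F \<noteq> {}" "inductive_subset F"
  shows "\<exists>p. F = {p..}"
proof
  define p where "p = (LEAST p. p \<in> F)"
  have "p \<in> F"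
    unfolding p_def using assms(1) by (auto intro: LeastI)
  have "n \<in> F" if "p \<le> n" for n
    using that
  proof (induction n rule: dec_induct)
    case base
    show ?case by fact
  next
    case (step n)
    then show ?case using assms(2) by (auto simp: inductive_subset_def)
  qed
  moreover have "p \<le> n" if "n \<in> F" for n
    unfolding p_def using that by (rule Least_le)
  ultimately show "F = {p..}" by auto
qed

text \<open>Moving \<open>{q..}\<close> down by \<open>q - p\<close> gives \<open>{p..}\<close>,
  which already lies inside \<open>{m..}\<close>. So the left endpoints have no gaps.\<close>

lemma omega_closed_atLeast_mem:
  assumes "omega_closed \<F>" "{m..} \<in> \<F>" "{q..} \<in> \<F>" "m \<le> p" "p \<le> q"
  shows "{p..} \<in> \<F>"
proof -
  have "inter_shift {m..} (- int (q - p)) {q..} \<in> \<F>"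
    using assms unfolding omega_closed_def by blast
  moreover have "inter_shift {m..} (- int (q - p)) {q..} = {p..}"
    using inter_shift_atLeast[of 0 "q - p" m q] assms by (simp add: max_def)
  ultimately show ?thesis by simp
qed

text \<open>Being injective on all triples, it has an inverse \<open>the_inv\<close> on its range
  with no restriction of the domain.\<close>

definition ext_embed :: "nat \<Rightarrow> nat \<times> nat \<times> nat \<Rightarrow> nat \<times> nat \<times> nat set" where
  "ext_embed m = (\<lambda>(i, j, p). (i, j, {m + p..}))"

lemma inj_ext_embed: "inj (ext_embed m)"
  by (auto simp: inj_def ext_embed_def)

lemma B_mult_ext_embed:
  "B_mult (ext_embed m x) (ext_embed m y) = ext_embed m (ext_mult x y)"
proof -
  obtain i j p i' j' p' where "x = (i, j, p)" "y = (i', j', p')"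
    by (metis prod.exhaust)
  then show ?thesis
    by (cases j i' rule: linorder_cases)
      (auto simp: ext_embed_def inter_shift_atLeast max_def)
qed

section \<open>Transport to the original monoid and the equivalences\<close>

theorem mainTheorem1:
  fixes \<F> :: "nat set set" and \<epsilon> :: "nat \<times> nat \<times> nat set \<Rightarrow> nat \<times> nat \<times> nat set"
  assumes "omega_closed \<F>"
    and "\<forall>F\<in>\<F>. F \<noteq> {} \<and> inductive_subset F"
    and "\<exists>F\<^sub>1\<in>\<F>. \<exists>F\<^sub>2\<in>\<F>. F\<^sub>1 \<noteq> F\<^sub>2"
    and "monoid_endomorphism (B_omega \<F>) \<epsilon>"
    and "inj_on \<epsilon> (carrier (B_omega \<F>))"
  shows "((\<forall>x\<in>carrier (B_omega \<F>). \<epsilon> x = x) \<longleftrightarrow>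
           (\<exists>i j p. (i, j, {p..}) \<in> carrier (B_omega \<F>) \<and>
              (i, j, {p..}) \<otimes>\<^bsub>B_omega \<F>\<^esub> (i, j, {p..}) \<noteq> (i, j, {p..}) \<and>
              \<epsilon> (i, j, {p..}) = (i, j, {p..}))) \<and>
         ((\<forall>x\<in>carrier (B_omega \<F>). \<epsilon> x = x) \<longleftrightarrow>
           (\<exists>x y z. {x, y, z} \<subseteq> fixed_points (B_omega \<F>) \<epsilon> \<and> x \<noteq> y \<and> y \<noteq> z \<and> x \<noteq> z))"
proof -
  define C where "C = carrier (B_omega \<F>)"
  define m where "m = (LEAST p. {p..} \<in> \<F>)"
  define P where "P = {p. {m + p..} \<in> \<F>}"
  let ?S = "UNIV \<times> UNIV \<times> P"
  let ?E = "ext_embed m"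
  have atLeast: "\<exists>p. F = {p..}" if "F \<in> \<F>" for F
    using that assms(2) inductive_subset_eq_atLeast by blast
  then have m: "{m..} \<in> \<F>"
    unfolding m_def using assms(3) by (metis LeastI)
  have m_le: "m \<le> p" if "{p..} \<in> \<F>" for p
    unfolding m_def using that by (rule Least_le)
  have C: "C = ?E ` ?S"
  proof -
    have "\<exists>p\<in>P. F = {m + p..}" if "F \<in> \<F>" for F
      using atLeast[OF that] m_le that unfolding P_def by (metis le_add_diff_inverse mem_Collect_eq)
    then show ?thesis
      by (fastforce simp: C_def B_omega_def ext_embed_def P_def image_iff)
  qed
  \<comment> \<open>The order on sets is inclusion, so the least left endpoint gives the greatest
    member.\<close>
  have "(GREATEST F. F \<in> \<F>) = {m..}"
    using m atLeast m_le by (intro Greatest_equality) (blast, metis atLeast_subset_iff)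
  then have one: "\<one>\<^bsub>B_omega \<F>\<^esub> = ?E (0, 0, 0)"
    by (simp add: B_omega_def ext_embed_def)
  have mult: "?E x \<otimes>\<^bsub>B_omega \<F>\<^esub> ?E y = ?E (ext_mult x y)" for x y
    by (simp add: B_omega_def B_mult_ext_embed)
  have \<epsilon>_closed: "\<epsilon> x \<in> C" if "x \<in> C" for x
    using assms(4) that by (auto simp: C_def monoid_endomorphism_def hom_def)
  have \<epsilon>_mult: "\<epsilon> (x \<otimes>\<^bsub>B_omega \<F>\<^esub> y) = \<epsilon> x \<otimes>\<^bsub>B_omega \<F>\<^esub> \<epsilon> y"
    if "x \<in> C" "y \<in> C" for x y
    using assms(4) that by (auto simp: C_def monoid_endomorphism_def hom_def)
  define \<phi> where "\<phi> = the_inv ?E \<circ> \<epsilon> \<circ> ?E"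
  have \<phi>: "\<phi> x \<in> ?S" "?E (\<phi> x) = \<epsilon> (?E x)" if x: "x \<in> ?S" for x
  proof -
    obtain y where "y \<in> ?S" "\<epsilon> (?E x) = ?E y"
      using \<epsilon>_closed[of "?E x"] x C by blast
    moreover then have "\<phi> x = y"
      by (simp add: \<phi>_def the_inv_f_f inj_ext_embed)
    ultimately show "\<phi> x \<in> ?S" "?E (\<phi> x) = \<epsilon> (?E x)" by simp_all
  qed
  have E_cancel: "?E x = ?E y \<longleftrightarrow> x = y" for x y
    using inj_ext_embed by (simp add: inj_eq)
  have fixed_iff: "\<epsilon> (?E x) = ?E x \<longleftrightarrow> \<phi> x = x" if "x \<in> ?S" for x
    using \<phi>(2)[OF that] E_cancel by metis
  interpret ext_bicyclic_endomorphism P \<phi>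
  proof
    show zero: "0 \<in> P" using m by (simp add: P_def)
    show "p \<in> P" if "q \<in> P" "p \<le> q" for p q
      using omega_closed_atLeast_mem[OF assms(1) m, of "m + q" "m + p"] that by (simp add: P_def)
    show "snd (snd (\<phi> (i, j, p))) \<in> P" if "p \<in> P" for i j p
      using \<phi>(1)[of "(i, j, p)"] that by (simp add: mem_Times_iff)
    show "\<phi> (ext_mult (i, j, p) (i', j', q)) = ext_mult (\<phi> (i, j, p)) (\<phi> (i', j', q))"
      if "p \<in> P" "q \<in> P" for p q i j i' j'
    proof -
      have S: "(i, j, p) \<in> ?S" "(i', j', q) \<in> ?S" using that by auto
      have "?E (ext_mult (\<phi> (i, j, p)) (\<phi> (i', j', q))) =
          \<epsilon> (?E (i, j, p)) \<otimes>\<^bsub>B_omega \<F>\<^esub> \<epsilon> (?E (i', j', q))"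
        using \<phi>(2)[OF S(1)] \<phi>(2)[OF S(2)] by (simp flip: mult)
      also have "\<dots> = \<epsilon> (?E (ext_mult (i, j, p) (i', j', q)))"
        using \<epsilon>_mult S C mult by (metis imageI)
      finally show ?thesis
        by (metis \<phi>_def comp_apply inj_ext_embed the_inv_f_f)
    qed
    show "\<phi> (0, 0, 0) = (0, 0, 0)"
      using fixed_iff[of "(0, 0, 0)"] assms(4) one zero by (simp add: monoid_endomorphism_def)
    show "inj_on \<phi> ?S"
    proof (rule inj_onI)
      fix x y assume xy: "x \<in> ?S" "y \<in> ?S" "\<phi> x = \<phi> y"
      then have "\<epsilon> (?E x) = \<epsilon> (?E y)" using \<phi>(2) by metis
      then show "x = y"
        using assms(5) xy C E_cancel unfolding C_def[symmetric] by (metis imageI inj_onD)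
    qed
  qed
  let ?id = "\<forall>x\<in>C. \<epsilon> x = x"
  let ?nonidem = "\<exists>i j p. (i, j, {p..}) \<in> C \<and>
    (i, j, {p..}) \<otimes>\<^bsub>B_omega \<F>\<^esub> (i, j, {p..}) \<noteq> (i, j, {p..}) \<and>
    \<epsilon> (i, j, {p..}) = (i, j, {p..})"
  let ?three = "\<exists>x y z. {x, y, z} \<subseteq> fixed_points (B_omega \<F>) \<epsilon> \<and> x \<noteq> y \<and> y \<noteq> z \<and> x \<noteq> z"
  \<comment> \<open>All implications pass through \<open>scale = 1\<close>: it yields the identity
    map, and each of the other two conditions yields it.\<close>
  have id: ?id if "scale = 1"
  proof
    fix x assume "x \<in> C"
    then obtain i j p where "x = ?E (i, j, p)" "p \<in> P"
      using C by auto
    then show "\<epsilon> x = x"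
      using identity_if_scale_one[OF that] fixed_iff by simp
  qed
  have nonidem: ?nonidem if ?id
  proof -
    have "(0, 1, {m..}) = ?E (0, 1, 0)"
      by (simp add: ext_embed_def)
    moreover from this have "(0, 1, {m..}) \<in> C"
      using C zero_mem by blast
    moreover have "?E (0, 1, 0) \<otimes>\<^bsub>B_omega \<F>\<^esub> ?E (0, 1, 0) \<noteq> ?E (0, 1, 0)"
      by (simp add: mult E_cancel)
    ultimately show ?thesis
      using that by metis
  qed
  have three: ?three if ?id
  proof -
    \<comment> \<open>The identity and the two shift generators are three distinct elements in any
      such monoid.\<close>
    have "{?E (0, 0, 0), ?E (0, 1, 0), ?E (1, 0, 0)} \<subseteq> C"
      using C zero_mem by blast
    then have "{?E (0, 0, 0), ?E (0, 1, 0), ?E (1, 0, 0)} \<subseteq> fixed_points (B_omega \<F>) \<epsilon>"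
      using that by (auto simp: fixed_points_def C_def)
    moreover have "?E (0, 0, 0) \<noteq> ?E (0, 1, 0)" "?E (0, 1, 0) \<noteq> ?E (1, 0, 0)"
        "?E (0, 0, 0) \<noteq> ?E (1, 0, 0)"
      by (simp_all add: E_cancel)
    ultimately show ?thesis by blast
  qed
  have "scale = 1" if ?nonidem
  proof -
    from that obtain x where x: "x \<in> C" "x \<otimes>\<^bsub>B_omega \<F>\<^esub> x \<noteq> x" "\<epsilon> x = x"
      by blast
    then obtain i j p where ijp: "x = ?E (i, j, p)" "p \<in> P"
      using C by auto
    then have "i \<noteq> j"
      using x(2) by (metis E_cancel mult ext_mult_idem_iff)
    then show ?thesis
      using scale_one_if_nonidempotent_fixed ijp x(3) fixed_iff by auto
  qed
  moreover have "scale = 1" if ?three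
  proof -
    from that obtain x y z where "x \<in> C" "y \<in> C" "z \<in> C" "\<epsilon> x = x" "\<epsilon> y = y" "\<epsilon> z = z"
        and "x \<noteq> y" "y \<noteq> z" "x \<noteq> z"
      unfolding fixed_points_def C_def by blast
    moreover from this(1-3) obtain x' y' z' where "x = ?E x'" "y = ?E y'" "z = ?E z'"
        "x' \<in> ?S" "y' \<in> ?S" "z' \<in> ?S"
      unfolding C by blast
    ultimately show ?thesis
      using scale_one_if_three_fixed[of x' y' z'] fixed_iff by metis
  qed
  ultimately show ?thesis
    using id nonidem three unfolding C_def[symmetric] by blast
qed

end
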